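(* Let $A, B$ be alphabets, let $F$ be a finite monoid, and let $\varphi : A^{*} \to F$, $\psi : B^{*} \to F$ be epimorphisms of monoids. If the fiber product $\Pi(\varphi,\psi) = \{(u,v) \in A^{*}\times B^{*} : \varphi(u) = \psi(v)\}$ is finitely generated (as a monoid), then it is also finitely presented (as a monoid).
   Context: For an alphabet $A$, $A^{*}$ is the free monoid of all finite words over $A$ (including the empty word) under concatenation. "Epimorphism" means surjective homomorphism. $\Pi(\varphi,\psi)$ is a submonoid of the direct product $A^{*}\times B^{*}$. A monoid is finitely presented if it is isomorphic to $\Gamma^{*}/R^{\sharp}$ for some finite set $\Gamma$ and some finite $R \subseteq \Gamma^{*}\times\Gamma^{*}$, where $R^{\sharp}$ is the congruence on $\Gamma^{*}$ generated by $R$. *)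

theory Defs
  imports "HOL-Algebra.Group" "HOL.Hull"
begin

definition free_monoid :: "'a set \<Rightarrow> 'a list monoid" where
  "free_monoid A = \<lparr>carrier = lists A, mult = (@), one = []\<rparr>"

definition finitely_generated_monoid :: "('a, 'm) monoid_scheme \<Rightarrow> bool" where
  "finitely_generated_monoid M \<longleftrightarrow>
     (\<exists>X. finite X \<and> X \<subseteq> carrier M \<and> (\<lambda>H. submonoid H M) hull X = carrier M)"

definition monoid_congruence :: "('a, 'm) monoid_scheme \<Rightarrow> ('a \<times> 'a) set \<Rightarrow> bool" where
  "monoid_congruence M r \<longleftrightarrow>
     equiv (carrier M) r \<and>
     (\<forall>x y x' y'. (x, y) \<in> r \<longrightarrow> (x', y') \<in> r \<longrightarrow> (x \<otimes>\<^bsub>M\<^esub> x', y \<otimes>\<^bsub>M\<^esub> y') \<in> r)"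

definition generated_congruence ::
    "('a, 'm) monoid_scheme \<Rightarrow> ('a \<times> 'a) set \<Rightarrow> ('a \<times> 'a) set" where
  "generated_congruence M R = monoid_congruence M hull R"

text \<open>
  For a congruence the union below is the single class of \<open>x \<otimes> y\<close> for any
  representatives \<open>x\<close>, \<open>y\<close>; see \<open>quotient_monoid_mult\<close>.
\<close>

definition quotient_monoid ::
    "('a, 'm) monoid_scheme \<Rightarrow> ('a \<times> 'a) set \<Rightarrow> 'a set monoid" where
  "quotient_monoid M r =
     \<lparr>carrier = carrier M // r,
      mult = (\<lambda>X Y. \<Union>x\<in>X. \<Union>y\<in>Y. r `` {x \<otimes>\<^bsub>M\<^esub> y}),
      one = r `` {\<one>\<^bsub>M\<^esub>}\<rparr>"

text \<open>
  Only the cardinality of the finite alphabet \<open>\<Gamma>\<close> matters, so it is no restriction to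
  take its letters from the natural numbers. A bijection that preserves multiplication
  also preserves the identity, so the group-theoretic \<open>\<cong>\<close> is isomorphism of monoids.
\<close>

definition finitely_presented_monoid :: "('a, 'm) monoid_scheme \<Rightarrow> bool" where
  "finitely_presented_monoid M \<longleftrightarrow>
     (\<exists>(\<Gamma> :: nat set) R. finite \<Gamma> \<and> finite R \<and> R \<subseteq> lists \<Gamma> \<times> lists \<Gamma> \<and>
        M \<cong> quotient_monoid (free_monoid \<Gamma>) (generated_congruence (free_monoid \<Gamma>) R))"

definition fiber_product ::
    "('a, 'm) monoid_scheme \<Rightarrow> ('b, 'n) monoid_scheme \<Rightarrow> ('a \<Rightarrow> 'f) \<Rightarrow> ('b \<Rightarrow> 'f) \<Rightarrow> ('a \<times> 'b) monoid"
  where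
  "fiber_product G H \<phi> \<psi> =
     (G \<times>\<times> H)\<lparr>carrier := {(u, v) \<in> carrier G \<times> carrier H. \<phi> u = \<psi> v}\<rparr>"

text \<open>
  The library's \<open>hom\<close> and \<open>epi\<close> do not ask for the identity to be preserved, but a
  surjective multiplicative map preserves it.
\<close>

lemma epi_monoid_one:
  assumes "monoid G" "monoid H" "\<phi> \<in> epi G H"
  shows "\<phi> \<one>\<^bsub>G\<^esub> = \<one>\<^bsub>H\<^esub>"
proof -
  interpret G: monoid G by fact
  interpret H: monoid H by fact
  have hom: "\<phi> \<in> hom G H" and surj: "\<phi> ` carrier G = carrier H"
    using assms(3) by (auto simp: epi_def)
  obtain x where x: "x \<in> carrier G" "\<phi> x = \<one>\<^bsub>H\<^esub>"
    using surj H.one_closed by (metis imageE)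
  have "\<phi> \<one>\<^bsub>G\<^esub> = \<phi> \<one>\<^bsub>G\<^esub> \<otimes>\<^bsub>H\<^esub> \<phi> x"
    using hom x(2) by (simp add: hom_in_carrier)
  also have "\<dots> = \<phi> (\<one>\<^bsub>G\<^esub> \<otimes>\<^bsub>G\<^esub> x)"
    by (rule hom_mult[OF hom G.one_closed x(1), symmetric])
  finally show ?thesis
    using x by simp
qed

lemma free_monoid_simps [simp]:
  "carrier (free_monoid A) = lists A"
  "x \<otimes>\<^bsub>free_monoid A\<^esub> y = x @ y"
  "\<one>\<^bsub>free_monoid A\<^esub> = []"
  by (simp_all add: free_monoid_def)

lemma monoid_free_monoid: "monoid (free_monoid A)"
  by unfold_locales auto

lemma monoid_congruence_generated:
  assumes "monoid M" "R \<subseteq> carrier M \<times> carrier M"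
  shows "monoid_congruence M (generated_congruence M R)"
proof -
  interpret monoid M by fact
  have full: "monoid_congruence M (carrier M \<times> carrier M)"
    by (auto simp: monoid_congruence_def equiv_def refl_on_def sym_on_def trans_on_def)
  let ?C = "{r. monoid_congruence M r \<and> R \<subseteq> r}"
  have eq: "r \<subseteq> carrier M \<times> carrier M" "refl_on (carrier M) r" "sym r" "trans r" if "r \<in> ?C" for r
    using that by (simp_all add: monoid_congruence_def equiv_def)
  have ne: "carrier M \<times> carrier M \<in> ?C"
    using full assms(2) by simp
  have "equiv (carrier M) (\<Inter>?C)"
  proof (rule equivI)
    show "\<Inter>?C \<subseteq> carrier M \<times> carrier M"
      using ne by (rule Inter_lower)
    show "refl_on (carrier M) (\<Inter>?C)"
      using eq(2) by (intro refl_onI InterI) (rule refl_onD)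
    show "sym (\<Inter>?C)"
      using eq(3) by (intro symI InterI) (meson InterD symD)
    show "trans (\<Inter>?C)"
      using eq(4) by (intro transI InterI) (meson InterD transD)
  qed
  then show ?thesis
    unfolding generated_congruence_def hull_def monoid_congruence_def by blast
qed

lemma quotient_monoid_mult:
  assumes "monoid_congruence M r" "x \<in> carrier M" "y \<in> carrier M"
  shows "r `` {x} \<otimes>\<^bsub>quotient_monoid M r\<^esub> r `` {y} = r `` {x \<otimes>\<^bsub>M\<^esub> y}"
proof -
  have eq: "equiv (carrier M) r"
    using assms(1) by (simp add: monoid_congruence_def)
  have class_eq: "r `` {x' \<otimes>\<^bsub>M\<^esub> y'} = r `` {x \<otimes>\<^bsub>M\<^esub> y}"
    if "(x, x') \<in> r" "(y, y') \<in> r" for x' y'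
  proof -
    have "(x \<otimes>\<^bsub>M\<^esub> y, x' \<otimes>\<^bsub>M\<^esub> y') \<in> r"
      using that assms(1) unfolding monoid_congruence_def by blast
    then show ?thesis
      by (rule equiv_class_eq[OF eq, symmetric])
  qed
  have "x \<in> r `` {x}" "y \<in> r `` {y}"
    using equiv_class_self[OF eq] assms(2,3) by simp_all
  have "(\<Union>x'\<in>r `` {x}. \<Union>y'\<in>r `` {y}. r `` {x' \<otimes>\<^bsub>M\<^esub> y'})
      = (\<Union>x'\<in>r `` {x}. \<Union>y'\<in>r `` {y}. r `` {x \<otimes>\<^bsub>M\<^esub> y})"
    by (intro SUP_cong refl class_eq) blast+
  also have "\<dots> = r `` {x \<otimes>\<^bsub>M\<^esub> y}"
    using \<open>x \<in> r `` {x}\<close> \<open>y \<in> r `` {y}\<close> by blast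
  finally show ?thesis
    by (simp add: quotient_monoid_def)
qed

lemma submonoid_fiber_product:
  assumes "monoid G" "monoid H" "monoid F" "\<phi> \<in> epi G F" "\<psi> \<in> epi H F"
  shows "submonoid (carrier (fiber_product G H \<phi> \<psi>)) (G \<times>\<times> H)"
proof -
  interpret G: monoid G by fact
  interpret H: monoid H by fact
  have "\<phi> \<in> hom G F" "\<psi> \<in> hom H F"
    using assms by (auto simp: epi_def)
  then show ?thesis
    using epi_monoid_one[OF assms(1,3,4)] epi_monoid_one[OF assms(2,3,5)]
    by (intro submonoid.intro) (auto simp: fiber_product_def hom_mult)
qed

end

theory Submission
  imports Defs "HOL-Library.Sublist"
begin

text \<open>
  Call the fiber product \<open>M\<close>. Two ideas carry the proof.

  Finite generation forces \<open>F\<close> to be a group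
  (\<open>group_if_fiber_product_finitely_generated\<close>). For a letter \<open>a\<close> pair the long words
  \<open>a\<^sup>n\<close> with words over \<open>B\<close> of bounded length that have the same image in \<open>F\<close>. A
  factorization of such a pair into generators must contain a factor \<open>(a\<^sup>k, [])\<close> with
  \<open>k > 0\<close>, so \<open>\<phi> a\<close> has finite order, and \<open>F\<close> consists of products of such units.

  In a group one can cancel, and therefore, for elements of \<open>M\<close>, left divisibility in \<open>M\<close>
  is just the prefix order in both components. The left divisors of \<open>(u, v)\<close> in \<open>M\<close> become points
  of a grid, and a factorization of \<open>(u, v)\<close> becomes a chain of such points from the origin to
  \<open>(u, v)\<close>. Suppose that two chains start with different generators \<open>(x\<^sub>1, x\<^sub>2)\<close>
  and \<open>(y\<^sub>1, y\<^sub>2)\<close>. If these are comparable, the larger one is a common right multiple of both.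
  If, say, \<open>x\<^sub>1\<close> is a prefix of \<open>y\<^sub>1\<close> but \<open>y\<^sub>2\<close> a prefix of
  \<open>x\<^sub>2\<close>, then either \<open>u\<close> is long enough to walk from \<open>(x\<^sub>1, x\<^sub>2)\<close> along
  the first coordinate, by short words in the kernel of \<open>\<phi>\<close>, until \<open>y\<^sub>1\<close> has been passed;
  or \<open>v\<close> is long enough to walk from \<open>(y\<^sub>1, y\<^sub>2)\<close> along the second coordinate; or both
  words are short and \<open>(u, v)\<close> itself will do. In every case there is a common right multiple of
  bounded length that still divides \<open>(u, v)\<close> (\<open>bounded_common_extension\<close>). The kernel words
  needed for the walk are short because an element \<open>(w, [])\<close> of \<open>M\<close> is a product of
  generators \<open>(w\<^sub>i, [])\<close>.

  Bounded common right multiples yield a finite presentation: the relations between words of bounded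
  length suffice, by induction on the length of the element that the words represent
  (\<open>finitely_presented_if_bounded_common_multiples\<close>).
\<close>


section \<open>Evaluating words in a monoid\<close>

definition word_value :: "('a, 'm) monoid_scheme \<Rightarrow> ('i \<Rightarrow> 'a) \<Rightarrow> 'i list \<Rightarrow> 'a" where
  "word_value M e w = foldr (\<lambda>i m. e i \<otimes>\<^bsub>M\<^esub> m) w \<one>\<^bsub>M\<^esub>"

lemma word_value_simps [simp]:
  "word_value M e [] = \<one>\<^bsub>M\<^esub>"
  "word_value M e (i # w) = e i \<otimes>\<^bsub>M\<^esub> word_value M e w"
  by (simp_all add: word_value_def)

definition word_kernel ::
    "('a, 'm) monoid_scheme \<Rightarrow> ('i \<Rightarrow> 'a) \<Rightarrow> 'i set \<Rightarrow> ('i list \<times> 'i list) set" where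
  "word_kernel M e I = {(v, w) \<in> lists I \<times> lists I. word_value M e v = word_value M e w}"

context monoid
begin

lemma word_value_closed:
  assumes "e ` I \<subseteq> carrier G" "w \<in> lists I"
  shows "word_value G e w \<in> carrier G"
  using assms(2,1) by (induction w) auto

lemma word_value_append:
  assumes "e ` I \<subseteq> carrier G" "v \<in> lists I" "w \<in> lists I"
  shows "word_value G e (v @ w) = word_value G e v \<otimes> word_value G e w"
  using assms(2,1,3)
proof (induction v)
  case Nil
  then show ?case by (simp add: word_value_closed)
next
  case (Cons i v)
  then show ?case
    using word_value_closed[of e I v] word_value_closed[of e I w] by (simp add: m_assoc image_subset_iff)
qed

text \<open>
  The identity is removed from the generators here, so that later every letter can have positive
  length and the length of an element bounds the length of the words that represent it.
\<close>

lemma word_value_eq_if_hull: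
  assumes X: "X \<subseteq> carrier G" and hull: "(\<lambda>H. submonoid H G) hull X = carrier G"
    and e: "e ` I = X - {\<one>}" and m: "m \<in> carrier G"
  obtains w where "w \<in> lists I" "word_value G e w = m"
proof -
  let ?V = "word_value G e ` lists I"
  have eX: "e ` I \<subseteq> carrier G"
    using e X by blast
  have "submonoid ?V G"
  proof
    show "?V \<subseteq> carrier G"
      using word_value_closed[OF eX] by blast
    show "x \<otimes> y \<in> ?V" if xy: "x \<in> ?V" "y \<in> ?V" for x y
    proof -
      obtain v w where "v \<in> lists I" "w \<in> lists I" "x = word_value G e v" "y = word_value G e w"
        using xy by blast
      then show ?thesis
        using word_value_append[OF eX, of v w] by (metis append_in_lists_conv image_eqI)
    qed
    have "word_value G e [] \<in> ?V" by blast
    then show "\<one> \<in> ?V" by simp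
  qed
  moreover have "X \<subseteq> ?V"
  proof
    fix x assume x: "x \<in> X"
    show "x \<in> ?V"
    proof (cases "x = \<one>")
      case True
      have "word_value G e [] \<in> ?V" by blast
      with True show ?thesis by simp
    next
      case False
      then have "x \<in> e ` I"
        using e x by simp
      then obtain i where "i \<in> I" "e i = x"
        by blast
      moreover have "x \<in> carrier G" using x X by blast
      ultimately have "word_value G e [i] = x" "[i] \<in> lists I" by simp_all
      then show ?thesis by (metis imageI)
    qed
  qed
  ultimately have "carrier G \<subseteq> ?V"
    using hull_minimal[of X ?V "\<lambda>H. submonoid H G"] hull by simp
  with m have "m \<in> ?V" by blast
  then show thesis
    using that by blast
qed

lemma monoid_congruence_word_kernel:
  assumes "e ` I \<subseteq> carrier G"
  shows "monoid_congruence (free_monoid I) (word_kernel G e I)"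
  using word_value_append[OF assms]
  by (auto simp: word_kernel_def monoid_congruence_def equiv_def refl_on_def sym_on_def trans_on_def)

text \<open>
  This reduces finite presentability to a statement about words alone: the monoid is the quotient of
  the free monoid by the kernel of evaluation, so it is enough that finitely many pairs of the
  kernel lie in no smaller congruence. The isomorphism sends an element to the set of words that
  represent it.
\<close>

lemma finitely_presented_if_kernel_generated:
  fixes e :: "nat \<Rightarrow> 'a"
  assumes "finite I" and e: "e ` I \<subseteq> carrier G"
    and surj: "word_value G e ` lists I = carrier G"
    and "finite R"
    and R: "R \<subseteq> word_kernel G e I"
    and min: "\<And>r. monoid_congruence (free_monoid I) r \<Longrightarrow> R \<subseteq> r \<Longrightarrow> word_kernel G e I \<subseteq> r"
  shows "finitely_presented_monoid G"
proof -
  let ?W = "free_monoid I" and ?K = "word_kernel G e I"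
  have K: "monoid_congruence ?W ?K"
    by (rule monoid_congruence_word_kernel[OF e])
  have gen: "generated_congruence ?W R = ?K"
    unfolding generated_congruence_def using K R min
    by (auto simp: hull_def)
  let ?h = "\<lambda>m. {w \<in> lists I. word_value G e w = m}"
  have cls: "?K `` {w} = ?h (word_value G e w)" if "w \<in> lists I" for w
    using that by (auto simp: word_kernel_def)
  have quot: "lists I // ?K = ?h ` carrier G"
    unfolding surj[symmetric] quotient_def image_image using cls by auto
  have "?h \<in> iso G (quotient_monoid ?W ?K)"
  proof (rule isoI)
    show "?h \<in> hom G (quotient_monoid ?W ?K)"
    proof (rule homI)
      show "?h x \<in> carrier (quotient_monoid ?W ?K)" if "x \<in> carrier G" for x
        using that quot by (auto simp: quotient_monoid_def)
      show "?h (x \<otimes> y) = ?h x \<otimes>\<^bsub>quotient_monoid ?W ?K\<^esub> ?h y"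
        if "x \<in> carrier G" "y \<in> carrier G" for x y
      proof -
        obtain v w where vw: "v \<in> lists I" "w \<in> lists I"
          "x = word_value G e v" "y = word_value G e w"
          using \<open>x \<in> carrier G\<close> \<open>y \<in> carrier G\<close> surj by (metis imageE)
        show ?thesis
          using quotient_monoid_mult[OF K, of v w] vw
          by (simp add: cls word_value_append[OF e vw(1,2), symmetric])
      qed
    qed
    have "inj_on ?h (carrier G)"
    proof (rule inj_onI)
      fix x y assume "x \<in> carrier G" and eq: "?h x = ?h y"
      then have "x \<in> word_value G e ` lists I"
        using surj by simp
      then obtain w where "w \<in> lists I" "word_value G e w = x"
        by (metis imageE)
      then have "w \<in> ?h x" by simp
      then have "w \<in> ?h y" using eq by simp
      with \<open>word_value G e w = x\<close> show "x = y" by simp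
    qed
    then show "bij_betw ?h (carrier G) (carrier (quotient_monoid ?W ?K))"
      using quot by (simp add: bij_betw_def quotient_monoid_def)
  qed
  then have iso: "G \<cong> quotient_monoid ?W (generated_congruence ?W R)"
    unfolding gen is_iso_def by blast
  show ?thesis
    unfolding finitely_presented_monoid_def
    using \<open>finite I\<close> \<open>finite R\<close> R iso unfolding word_kernel_def by blast
qed

end


section \<open>A presentation from bounded common multiples\<close>

text \<open>
  Let \<open>x v\<close> and \<open>y w\<close> be two words for the same element, with first letters \<open>x\<close> and
  \<open>y\<close>, and let \<open>z = x a = y b\<close> be a common right multiple of bounded length with
  \<open>z c\<close> equal to that element. By cancellation \<open>v\<close> and \<open>a c\<close> represent the same
  element, which is shorter, and so do \<open>w\<close> and \<open>b c\<close>. By induction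
  \<open>x v \<sim> x a c\<close> and \<open>y w \<sim> y b c\<close>, while \<open>x a \<sim> y b\<close> is one of the finitely
  many relations between words of length at most \<open>C\<close>.
\<close>

lemma (in monoid) finitely_presented_if_bounded_common_multiples:
  fixes len :: "'a \<Rightarrow> nat" and C :: nat
  assumes fin: "finite X" and X: "X \<subseteq> carrier G"
    and hull: "(\<lambda>H. submonoid H G) hull X = carrier G"
    and cancel: "\<And>x a b. \<lbrakk>x \<in> carrier G; a \<in> carrier G; b \<in> carrier G; x \<otimes> a = x \<otimes> b\<rbrakk> \<Longrightarrow> a = b"
    and len_mult: "\<And>x y. \<lbrakk>x \<in> carrier G; y \<in> carrier G\<rbrakk> \<Longrightarrow> len (x \<otimes> y) = len x + len y"
    and len_0: "\<And>x. \<lbrakk>x \<in> carrier G; len x = 0\<rbrakk> \<Longrightarrow> x = \<one>"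
    and mult: "\<And>x y p q. \<lbrakk>x \<in> X; y \<in> X; p \<in> carrier G; q \<in> carrier G; x \<otimes> p = y \<otimes> q\<rbrakk> \<Longrightarrow>
      \<exists>a\<in>carrier G. \<exists>b\<in>carrier G. \<exists>c\<in>carrier G.
        x \<otimes> a = y \<otimes> b \<and> x \<otimes> a \<otimes> c = x \<otimes> p \<and> len (x \<otimes> a) \<le> C"
  shows "finitely_presented_monoid G"
proof -
  obtain e :: "nat \<Rightarrow> 'a" and I where e: "e ` I = X - {\<one>}" and I: "finite I"
    using finite_imp_nat_seg_image_inj_on[of "X - {\<one>}"] fin
    by (metis finite_Diff finite_Collect_less_nat)
  have eG: "e ` I \<subseteq> carrier G"
    using e X by blast
  let ?val = "word_value G e"
  note closed = word_value_closed[OF eG]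
  have ex_word: "\<exists>w. w \<in> lists I \<and> ?val w = m" if "m \<in> carrier G" for m
    by (rule word_value_eq_if_hull[OF X hull e that]) blast
  have surj: "?val ` lists I = carrier G"
    using closed ex_word by (blast intro: sym)
  have e_pos: "1 \<le> len (e i)" if "i \<in> I" for i
    using len_0[of "e i"] that e eG by (metis DiffD2 imageI image_subset_iff less_one not_le singletonI)
  have length_le: "length w \<le> len (?val w)" if "w \<in> lists I" for w
    using that
  proof (induction w)
    case (Cons i w)
    then show ?case
      using e_pos[of i] len_mult[of "e i" "?val w"] eG closed[of w] by (auto simp: image_subset_iff)
  qed simp
  define R where "R = {(v, w). v \<in> lists I \<and> w \<in> lists I \<and> length v \<le> C \<and> length w \<le> C \<and> ?val v = ?val w}"
  have "finite {w. set w \<subseteq> I \<and> length w \<le> C}"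
    by (rule finite_lists_length_le[OF I])
  moreover have "R \<subseteq> {w. set w \<subseteq> I \<and> length w \<le> C} \<times> {w. set w \<subseteq> I \<and> length w \<le> C}"
    by (auto simp: R_def)
  ultimately have "finite R"
    by (meson finite_SigmaI finite_subset)
  show ?thesis
  proof (rule finitely_presented_if_kernel_generated[OF I eG surj \<open>finite R\<close>])
    show "R \<subseteq> word_kernel G e I"
      by (auto simp: R_def word_kernel_def)
  next
    fix r assume cong: "monoid_congruence (free_monoid I) r" and "R \<subseteq> r"
    have equiv: "equiv (lists I) r"
      using cong by (simp add: monoid_congruence_def)
    have r_refl: "(w, w) \<in> r" if "w \<in> lists I" for w
      using equiv that by (auto simp: equiv_def refl_on_def)
    have r_trans: "(u, w) \<in> r" if "(u, v) \<in> r" "(v, w) \<in> r" for u v w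
      using equiv that by (meson equivE transD)
    have r_sym: "(w, v) \<in> r" if "(v, w) \<in> r" for v w
      using equiv that by (meson equivE symD)
    have r_append: "(v @ v', w @ w') \<in> r" if "(v, w) \<in> r" "(v', w') \<in> r" for v w v' w'
      using cong that unfolding monoid_congruence_def by auto
    have "(v, w) \<in> r" if "v \<in> lists I" "w \<in> lists I" "?val v = ?val w" for v w
      using that
    proof (induction "len (?val v)" arbitrary: v w rule: less_induct)
      case less
      show ?case
      proof (cases "v = [] \<or> w = []")
        case True
        have "len \<one> = 0"
          using len_mult[of \<one> \<one>] by simp
        with True have "v = []" "w = []"
          using length_le[of v] length_le[of w] less.prems by auto
        then show ?thesis by (simp add: r_refl)
      next
        case False
        then obtain i v' j w' where vw: "v = i # v'" "w = j # w'"
          by (meson neq_Nil_conv)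
        then have ij: "i \<in> I" "j \<in> I" "v' \<in> lists I" "w' \<in> lists I"
          using less.prems by auto
        have in_G: "e i \<in> carrier G" "e j \<in> carrier G" "?val v' \<in> carrier G" "?val w' \<in> carrier G"
          using ij eG closed by auto
        have eq: "e i \<otimes> ?val v' = e j \<otimes> ?val w'"
          using less.prems(3) vw by simp
        have "e i \<in> X" "e j \<in> X"
          using ij e by blast+
        from mult[OF this in_G(3,4) eq] obtain a b c
          where abc: "a \<in> carrier G" "b \<in> carrier G" "c \<in> carrier G"
            and z: "e i \<otimes> a = e j \<otimes> b" "e i \<otimes> a \<otimes> c = e i \<otimes> ?val v'" "len (e i \<otimes> a) \<le> C"
          by blast
        obtain wa wb wc where words: "wa \<in> lists I" "wb \<in> lists I" "wc \<in> lists I"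
          and vals: "?val wa = a" "?val wb = b" "?val wc = c"
          using ex_word[OF abc(1)] ex_word[OF abc(2)] ex_word[OF abc(3)] by blast
        have "?val v' = a \<otimes> c"
          using cancel[of "e i" "?val v'" "a \<otimes> c"] z(2) in_G abc by (simp add: m_assoc)
        then have v': "?val v' = ?val (wa @ wc)"
          using words vals by (simp add: word_value_append[OF eG])
        have "e j \<otimes> ?val w' = e j \<otimes> (b \<otimes> c)"
          using z eq in_G abc by (simp add: m_assoc)
        then have "?val w' = b \<otimes> c"
          using cancel[of "e j" "?val w'" "b \<otimes> c"] in_G abc by simp
        then have w': "?val w' = ?val (wb @ wc)"
          using words vals by (simp add: word_value_append[OF eG])
        have "len (?val v) = len (e i) + len (?val v')"
          using len_mult[OF in_G(1,3)] vw by simp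
        moreover have "len (?val v) = len (e j) + len (?val w')"
          using len_mult[OF in_G(2,4)] less.prems(3) vw by simp
        ultimately have "len (?val v') < len (?val v)" "len (?val w') < len (?val v)"
          using e_pos[OF ij(1)] e_pos[OF ij(2)] by linarith+
        with less.hyps[of v' "wa @ wc"] less.hyps[of w' "wb @ wc"]
        have IH: "(v', wa @ wc) \<in> r" "(w', wb @ wc) \<in> r"
          using ij words v' w' by simp_all
        have "(i # wa, j # wb) \<in> R"
          using length_le[of "i # wa"] length_le[of "j # wb"] z words vals ij by (simp add: R_def)
        then have "((i # wa) @ wc, (j # wb) @ wc) \<in> r"
          using \<open>R \<subseteq> r\<close> words by (intro r_append r_refl) auto
        moreover have "([i] @ v', [i] @ wa @ wc) \<in> r" "([j] @ w', [j] @ wb @ wc) \<in> r"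
          using IH ij by (auto intro!: r_append r_refl simp del: append.simps)
        ultimately show ?thesis
          unfolding vw using r_trans r_sym by (metis append_Cons append_Nil)
      qed
    qed
    then show "word_kernel G e I \<subseteq> r"
      by (auto simp: word_kernel_def)
  qed
qed


section \<open>Homomorphisms from a free monoid to a group\<close>

text \<open>
  The kernel hypothesis speaks of words in the kernel, but every word \<open>w\<close> can be completed to one
  because \<open>F\<close> is a group and \<open>\<phi>\<close> is onto. If \<open>w\<close> has at least \<open>K\<close> letters, the
  short kernel prefix of the completion already lies inside \<open>w\<close>. Hence one can walk through
  \<open>w\<close> in steps of at most \<open>K\<close> letters, landing in the kernel each time, and so land in
  every window of \<open>K + 1\<close> consecutive lengths.
\<close>

lemma kernel_prefix_in_window:
  assumes "group F" and epi: "\<phi> \<in> epi (free_monoid A) F"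
    and bound: "\<And>w. \<lbrakk>w \<in> lists A; w \<noteq> []; \<phi> w = \<one>\<^bsub>F\<^esub>\<rbrakk> \<Longrightarrow>
      \<exists>k. 1 \<le> k \<and> k \<le> K \<and> \<phi> (take k w) = \<one>\<^bsub>F\<^esub>"
    and "w \<in> lists A" "n + K \<le> length w"
  shows "\<exists>s. n \<le> s \<and> s \<le> n + K \<and> \<phi> (take s w) = \<one>\<^bsub>F\<^esub>"
  using assms(5)
proof (induction n)
  case 0
  have "\<phi> [] = \<one>\<^bsub>F\<^esub>"
    using epi_monoid_one[OF monoid_free_monoid _ epi] \<open>group F\<close> by (simp add: group.is_monoid)
  then show ?case by (intro exI[of _ 0]) simp
next
  case (Suc n)
  interpret F: group F by fact
  have hom: "\<phi> \<in> hom (free_monoid A) F" and surj: "\<phi> ` lists A = carrier F"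
    using epi by (auto simp: epi_def)
  have app: "\<phi> (v @ w) = \<phi> v \<otimes>\<^bsub>F\<^esub> \<phi> w" if "v \<in> lists A" "w \<in> lists A" for v w
    using hom_mult[OF hom] that by simp
  obtain s where s: "n \<le> s" "s \<le> n + K" "\<phi> (take s w) = \<one>\<^bsub>F\<^esub>"
    using Suc by auto
  show ?case
  proof (cases "s = n")
    case False
    with s show ?thesis by (intro exI[of _ s]) simp
  next
    case True
    \<comment> \<open>The kernel prefix found so far is too short by one letter, so one more step is made.\<close>
    let ?d = "drop n w"
    have d: "?d \<in> lists A" "take n w \<in> lists A"
      using \<open>w \<in> lists A\<close> by (auto dest: in_set_dropD in_set_takeD)
    then have "\<phi> ?d \<in> carrier F" using surj by blast
    then have "inv\<^bsub>F\<^esub> \<phi> ?d \<in> \<phi> ` lists A"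
      using surj by simp
    then obtain t where t: "t \<in> lists A" "\<phi> t = inv\<^bsub>F\<^esub> \<phi> ?d"
      by (metis imageE)
    have "\<phi> (?d @ t) = \<one>\<^bsub>F\<^esub>"
      using app[OF d(1) t(1)] t \<open>\<phi> ?d \<in> carrier F\<close> by simp
    moreover have "?d @ t \<noteq> []" using Suc.prems by auto
    ultimately obtain k where k: "1 \<le> k" "k \<le> K" "\<phi> (take k (?d @ t)) = \<one>\<^bsub>F\<^esub>"
      using bound[of "?d @ t"] d t by auto
    have take_k: "take k (?d @ t) = take k ?d"
      using k Suc.prems by simp
    have "\<phi> (take k ?d) = \<one>\<^bsub>F\<^esub>"
      using k(3) by (simp only: take_k)
    moreover have "take k ?d \<in> lists A"
      using d by (auto dest: in_set_takeD)
    ultimately have "\<phi> (take (n + k) w) = \<one>\<^bsub>F\<^esub>"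
      using app[OF d(2), of "take k ?d"] s True by (simp add: take_add)
    with k show ?thesis by (intro exI[of _ "n + k"]) simp
  qed
qed

text \<open>
  This is one walk along a coordinate: from \<open>p\<close> past \<open>q\<close> without leaving the word
  \<open>u\<close>, keeping the image constant and overshooting \<open>q\<close> by at most \<open>K\<close>.
\<close>

lemma prefix_with_same_image:
  assumes "group F" and epi: "\<phi> \<in> epi (free_monoid A) F"
    and bound: "\<And>w. \<lbrakk>w \<in> lists A; w \<noteq> []; \<phi> w = \<one>\<^bsub>F\<^esub>\<rbrakk> \<Longrightarrow>
      \<exists>k. 1 \<le> k \<and> k \<le> K \<and> \<phi> (take k w) = \<one>\<^bsub>F\<^esub>"
    and u: "u \<in> lists A" "prefix p q" "prefix q u" "length q + K \<le> length u"
  shows "\<exists>r. prefix q r \<and> prefix r u \<and> length r \<le> length q + K \<and> \<phi> r = \<phi> p"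
proof -
  interpret F: group F by fact
  have hom: "\<phi> \<in> hom (free_monoid A) F"
    using epi by (auto simp: epi_def)
  obtain c d where cd: "q = p @ c" "u = p @ c @ d"
    using u by (auto elim!: prefixE)
  have "\<exists>s. length c \<le> s \<and> s \<le> length c + K \<and> \<phi> (take s (c @ d)) = \<one>\<^bsub>F\<^esub>"
    by (rule kernel_prefix_in_window[OF assms(1,2) bound]) (use u cd in auto)
  then obtain s where s: "length c \<le> s" "s \<le> length c + K" "\<phi> (take s (c @ d)) = \<one>\<^bsub>F\<^esub>"
    by blast
  have in_A: "p \<in> lists A" "take s (c @ d) \<in> lists A"
    using u cd by (auto dest: in_set_takeD)
  have "\<phi> (p @ take s (c @ d)) = \<phi> p"
    using hom_mult[OF hom, of p "take s (c @ d)"] s in_A hom_in_carrier[OF hom, of p] by simp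
  moreover have "prefix q (p @ take s (c @ d))" "prefix (p @ take s (c @ d)) u"
    using s cd by (simp_all add: take_is_prefix del: take_append) simp
  ultimately show ?thesis
    using s cd by (intro exI[of _ "p @ take s (c @ d)"]) simp
qed


section \<open>Fiber products of free monoids\<close>

lemma fiber_product_free_simps [simp]:
  "carrier (fiber_product (free_monoid A) (free_monoid B) \<phi> \<psi>)
     = {(u, v). u \<in> lists A \<and> v \<in> lists B \<and> \<phi> u = \<psi> v}"
  "(u, v) \<otimes>\<^bsub>fiber_product (free_monoid A) (free_monoid B) \<phi> \<psi>\<^esub> (u', v') = (u @ u', v @ v')"
  "\<one>\<^bsub>fiber_product (free_monoid A) (free_monoid B) \<phi> \<psi>\<^esub> = ([], [])"
  by (auto simp: fiber_product_def DirProd_def)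

lemma monoid_fiber_product_free:
  assumes "monoid F" "\<phi> \<in> epi (free_monoid A) F" "\<psi> \<in> epi (free_monoid B) F"
  shows "monoid (fiber_product (free_monoid A) (free_monoid B) \<phi> \<psi>)"
proof -
  have hom: "\<phi> \<in> hom (free_monoid A) F" "\<psi> \<in> hom (free_monoid B) F"
    using assms by (auto simp: epi_def)
  have one: "\<phi> [] = \<psi> []"
    using epi_monoid_one[OF monoid_free_monoid assms(1,2)]
      epi_monoid_one[OF monoid_free_monoid assms(1,3)] by simp
  have app: "\<phi> (u @ u') = \<psi> (v @ v')"
    if "u \<in> lists A" "u' \<in> lists A" "v \<in> lists B" "v' \<in> lists B" "\<phi> u = \<psi> v" "\<phi> u' = \<psi> v'" for u u' v v'
    using hom_mult[OF hom(1), of u u'] hom_mult[OF hom(2), of v v'] that by simp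
  show ?thesis
    by unfold_locales (auto simp: one intro!: app)
qed

text \<open>
  If no factor of a product of generators had the form \<open>(u, [])\<close> with \<open>u \<noteq> []\<close>, the first
  component would be at most \<open>K\<close> times as long as the second. The pair
  \<open>(a\<^sup>n, g (\<phi> a\<^sup>n))\<close> below violates this for large \<open>n\<close>: the words \<open>g f\<close> are
  preimages of the elements \<open>f\<close> of the finite monoid \<open>F\<close>, so their length is bounded.
\<close>

lemma group_if_fiber_product_finitely_generated:
  fixes \<phi> :: "'a list \<Rightarrow> 'f" and \<psi> :: "'b list \<Rightarrow> 'f"
  assumes "monoid F" and "finite (carrier F)"
    and epi: "\<phi> \<in> epi (free_monoid A) F" "\<psi> \<in> epi (free_monoid B) F"
    and bound: "\<And>x. x \<in> X \<Longrightarrow> length (fst x) \<le> K"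
    and X: "X \<subseteq> carrier (fiber_product (free_monoid A) (free_monoid B) \<phi> \<psi>)"
    and gen: "(\<lambda>H. submonoid H (fiber_product (free_monoid A) (free_monoid B) \<phi> \<psi>)) hull X
      = carrier (fiber_product (free_monoid A) (free_monoid B) \<phi> \<psi>)"
  shows "group F"
proof -
  let ?M = "fiber_product (free_monoid A) (free_monoid B) \<phi> \<psi>"
  interpret F: monoid F by fact
  interpret M: monoid ?M
    by (rule monoid_fiber_product_free[OF assms(1) epi])
  have hom: "\<phi> \<in> hom (free_monoid A) F" and surj: "\<phi> ` lists A = carrier F" "\<psi> ` lists B = carrier F"
    using epi by (auto simp: epi_def)
  have app: "\<phi> (v @ w) = \<phi> v \<otimes>\<^bsub>F\<^esub> \<phi> w" if "v \<in> lists A" "w \<in> lists A" for v w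
    using hom_mult[OF hom] that by simp
  have one: "\<phi> [] = \<one>\<^bsub>F\<^esub>"
    using epi_monoid_one[OF monoid_free_monoid assms(1) epi(1)] by simp
  obtain g where g: "\<And>f. f \<in> carrier F \<Longrightarrow> g f \<in> lists B \<and> \<psi> (g f) = f"
  proof -
    have "\<exists>w. w \<in> lists B \<and> \<psi> w = f" if "f \<in> carrier F" for f
      using that unfolding surj(2)[symmetric] by blast
    then show thesis using that by metis
  qed
  obtain D where D: "\<And>f. f \<in> carrier F \<Longrightarrow> length (g f) \<le> D"
    using finite_imageI[OF assms(2), of "\<lambda>f. length (g f)"]
    by (metis finite_nat_set_iff_bounded_le imageI)
  have unit: "\<phi> [a] \<in> Units F" if a: "a \<in> A" for a
  proof -
    define n where "n = K * D + 1"
    let ?u = "replicate n a"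
    have pow: "\<phi> (replicate k a) \<in> carrier F" "replicate k a \<in> lists A" for k
      using a surj(1) by (auto simp: in_lists_conv_set)
    have "(?u, g (\<phi> ?u)) \<in> carrier ?M"
      using g[OF pow(1)[of n]] pow(2)[of n] by auto
    then obtain w where w: "w \<in> lists (X - {\<one>\<^bsub>?M\<^esub>})" "word_value ?M (\<lambda>x. x) w = (?u, g (\<phi> ?u))"
      by (rule M.word_value_eq_if_hull[OF X gen image_ident])
    have "\<exists>x\<in>set w. snd x = [] \<and> fst x \<noteq> []"
    proof (rule ccontr)
      assume no: "\<not> ?thesis"
      have "length (fst (word_value ?M (\<lambda>x. x) w)) \<le> K * length (snd (word_value ?M (\<lambda>x. x) w))"
        using w(1) no
      proof (induction w rule: list.induct)
        case (Cons x w)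
        obtain u v where x: "x = (u, v)" by fastforce
        obtain u' v' where val: "word_value ?M (\<lambda>x. x) w = (u', v')" by fastforce
        have "x \<in> X" using Cons.prems(1) by simp
        then have "length u \<le> K" using bound[of x] x by simp
        moreover have "v = [] \<Longrightarrow> u = []" using Cons.prems(2) x by simp
        ultimately have "length u \<le> K * length v"
          by (cases v) simp_all
        moreover have "length (fst (word_value ?M (\<lambda>x. x) w)) \<le> K * length (snd (word_value ?M (\<lambda>x. x) w))"
          using Cons.prems by (intro Cons.IH) simp_all
        then have "length u' \<le> K * length v'" using val by simp
        ultimately show ?case using x val by (simp add: algebra_simps)
      qed simp
      also have "\<dots> \<le> K * D"
        using w(2) D[OF pow(1)[of n]] by simp
      finally show False using w(2) by (simp add: n_def)
    qed
    then obtain x where x: "x \<in> set w" "snd x = []" "fst x \<noteq> []" by blast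
    have "set (fst x) \<subseteq> set (fst (word_value ?M (\<lambda>x. x) w))" if "x \<in> set w" for x
      using that
    proof (induction w)
      case (Cons y w)
      then show ?case
        by (cases y; cases "word_value ?M (\<lambda>x. x) w") auto
    qed simp
    from this[OF x(1)] w(2) have "\<forall>b\<in>set (fst x). b = a"
      by (auto split: if_splits)
    then have "fst x = replicate (length (fst x)) a"
      by (rule replicate_length_same[symmetric])
    moreover have "length (fst x) = Suc (length (fst x) - 1)"
      using x(3) by simp
    ultimately obtain k where k: "fst x = replicate (Suc k) a"
      by metis
    have "x \<in> carrier ?M" using x w X by blast
    then have "\<phi> (fst x) = \<psi> []" "\<psi> [] = \<one>\<^bsub>F\<^esub>"
      using x(2) epi_monoid_one[OF monoid_free_monoid assms(1) epi(2)] by auto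
    then have "\<phi> (replicate (Suc k) a) = \<one>\<^bsub>F\<^esub>"
      using k by simp
    moreover have "replicate (Suc k) a = [a] @ replicate k a" "replicate (Suc k) a = replicate k a @ [a]"
      by (simp_all add: replicate_append_same)
    ultimately have "\<phi> [a] \<otimes>\<^bsub>F\<^esub> \<phi> (replicate k a) = \<one>\<^bsub>F\<^esub>"
      and "\<phi> (replicate k a) \<otimes>\<^bsub>F\<^esub> \<phi> [a] = \<one>\<^bsub>F\<^esub>"
      using app[of "[a]" "replicate k a"] app[of "replicate k a" "[a]"] pow(2)[of k] a by simp_all
    then show ?thesis
      using pow(1)[of k] pow(1)[of 1] unfolding Units_def by auto
  qed
  have "\<phi> u \<in> Units F" if "u \<in> lists A" for u
    using that
  proof (induction u)
    case Nil
    then show ?case using one by simp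
  next
    case (Cons a u)
    then show ?case
      using app[of "[a]" u] unit[of a] by simp
  qed
  then have "carrier F \<subseteq> Units F"
    unfolding surj(1)[symmetric] by blast
  then show "group F"
    by unfold_locales
qed

text \<open>
  Only the case in which \<open>x\<close> and \<open>y\<close> are ordered oppositely in the two components needs
  work. There the corner, \<open>(y1, x2)\<close> say, is the least upper bound for the prefix order of both
  components, but these may have different images; moving one component at most
  \<open>K\<close> letters further repairs that. The bound \<open>4 * K\<close> comes from the case in which neither \<open>u\<close> nor \<open>v\<close> has room for this: both are then shorter than
  \<open>2 * K\<close>.
\<close>

lemma bounded_common_extension:
  fixes \<phi> :: "'a list \<Rightarrow> 'f" and \<psi> :: "'b list \<Rightarrow> 'f"
  assumes ext1: "\<And>p q u. \<lbrakk>u \<in> lists A; prefix p q; prefix q u; length q + K \<le> length u\<rbrakk> \<Longrightarrow>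
      \<exists>r. prefix q r \<and> prefix r u \<and> length r \<le> length q + K \<and> \<phi> r = \<phi> p"
    and ext2: "\<And>p q v. \<lbrakk>v \<in> lists B; prefix p q; prefix q v; length q + K \<le> length v\<rbrakk> \<Longrightarrow>
      \<exists>r. prefix q r \<and> prefix r v \<and> length r \<le> length q + K \<and> \<psi> r = \<psi> p"
    and u: "u \<in> lists A" "v \<in> lists B" "\<phi> u = \<psi> v"
    and x: "prefix x1 u" "prefix x2 v" "\<phi> x1 = \<psi> x2" "length x1 \<le> K" "length x2 \<le> K"
    and y: "prefix y1 u" "prefix y2 v" "\<phi> y1 = \<psi> y2" "length y1 \<le> K" "length y2 \<le> K"
  shows "\<exists>z1 z2. prefix x1 z1 \<and> prefix y1 z1 \<and> prefix z1 u \<and> prefix x2 z2 \<and> prefix y2 z2 \<and>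
    prefix z2 v \<and> \<phi> z1 = \<psi> z2 \<and> length z1 + length z2 \<le> 4 * K"
proof -
  have opposite: "\<exists>z1 z2. prefix y1 z1 \<and> prefix z1 u \<and> prefix x2 z2 \<and>
      prefix z2 v \<and> \<phi> z1 = \<psi> z2 \<and> length z1 + length z2 \<le> 4 * K"
    if h: "prefix x1 y1" "prefix y2 x2" "prefix y1 u" "prefix x2 v"
      "\<phi> x1 = \<psi> x2" "\<phi> y1 = \<psi> y2" "length y1 \<le> K" "length x2 \<le> K"
    for x1 y1 x2 y2
  proof -
    consider "length y1 + K \<le> length u" | "length x2 + K \<le> length v"
      | "length u < length y1 + K" "length v < length x2 + K"
      by linarith
    then show ?thesis
    proof cases
      case 1
      then obtain r where "prefix y1 r" "prefix r u" "length r \<le> length y1 + K" "\<phi> r = \<phi> x1"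
        using ext1[OF u(1) h(1,3)] by blast
      then show ?thesis
        using that by (intro exI[of _ r] exI[of _ x2]) auto
    next
      case 2
      then obtain r where "prefix x2 r" "prefix r v" "length r \<le> length x2 + K" "\<psi> r = \<psi> y2"
        using ext2[OF u(2) h(2,4)] by blast
      then show ?thesis
        using that by (intro exI[of _ y1] exI[of _ r]) auto
    next
      case 3
      then show ?thesis
        using that u by (intro exI[of _ u] exI[of _ v]) auto
    qed
  qed
  have "prefix x1 y1 \<or> prefix y1 x1" "prefix x2 y2 \<or> prefix y2 x2"
    using x y by (meson prefix_same_cases)+
  then consider "prefix x1 y1" "prefix x2 y2" | "prefix y1 x1" "prefix y2 x2"
    | "prefix x1 y1" "prefix y2 x2" | "prefix y1 x1" "prefix x2 y2"
    by blast
  then show ?thesis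
  proof cases
    case 1
    then show ?thesis using x y by (intro exI[of _ y1] exI[of _ y2]) auto
  next
    case 2
    then show ?thesis using x y by (intro exI[of _ x1] exI[of _ x2]) auto
  next
    case 3
    then show ?thesis
      using opposite[OF 3 y(1) x(2,3) y(3,4) x(5)] by (meson prefix_order.trans)
  next
    case 4
    then show ?thesis
      using opposite[OF 4 x(1) y(2,3) x(3,4) y(5)] by (meson prefix_order.trans)
  qed
qed

theorem theorem3p5:
  fixes A :: "'a set" and B :: "'b set"
    and F :: "('f, 'm) monoid_scheme"
    and \<phi> :: "'a list \<Rightarrow> 'f" and \<psi> :: "'b list \<Rightarrow> 'f"
  assumes "monoid F" and "finite (carrier F)"
    and "\<phi> \<in> epi (free_monoid A) F"
    and "\<psi> \<in> epi (free_monoid B) F"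
    and "finitely_generated_monoid (fiber_product (free_monoid A) (free_monoid B) \<phi> \<psi>)"
  shows "finitely_presented_monoid (fiber_product (free_monoid A) (free_monoid B) \<phi> \<psi>)"
proof -
  let ?M = "fiber_product (free_monoid A) (free_monoid B) \<phi> \<psi>"
  interpret M: monoid ?M
    by (rule monoid_fiber_product_free[OF assms(1,3,4)])
  obtain X where X: "finite X" "X \<subseteq> carrier ?M" "(\<lambda>H. submonoid H ?M) hull X = carrier ?M"
    using assms(5) unfolding finitely_generated_monoid_def by blast
  have "finite ((\<lambda>x. length (fst x) + length (snd x)) ` X)"
    using X(1) by simp
  then obtain K where K0: "\<And>x. x \<in> X \<Longrightarrow> length (fst x) + length (snd x) \<le> K"
    unfolding finite_nat_set_iff_bounded_le by blast
  then have K: "length (fst x) \<le> K" "length (snd x) \<le> K" if "x \<in> X" for x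
    using that by (meson add_leD1 add_leD2)+
  interpret F: group F
    by (rule group_if_fiber_product_finitely_generated[OF assms(1-4) K(1) X(2,3)])
  have hom: "\<phi> \<in> hom (free_monoid A) F" "\<psi> \<in> hom (free_monoid B) F"
    using assms by (auto simp: epi_def)
  have one: "\<phi> [] = \<one>\<^bsub>F\<^esub>" "\<psi> [] = \<one>\<^bsub>F\<^esub>"
    using epi_monoid_one[OF monoid_free_monoid assms(1,3)]
      epi_monoid_one[OF monoid_free_monoid assms(1,4)] by simp_all
  have divisor: "\<exists>u v u' v'. (u, v) \<in> X \<and> (u, v) \<noteq> ([], []) \<and> (u, v) \<in> carrier ?M \<and>
      m = (u @ u', v @ v')"
    if m: "m \<in> carrier ?M" "m \<noteq> ([], [])" for m
  proof -
    obtain w where w: "w \<in> lists (X - {\<one>\<^bsub>?M\<^esub>})" "word_value ?M (\<lambda>x. x) w = m"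
      by (rule M.word_value_eq_if_hull[OF X(2,3) image_ident m(1)])
    with m obtain x w' where w': "w = x # w'"
      by (cases w) auto
    obtain u v where x: "x = (u, v)" by fastforce
    obtain u' v' where "word_value ?M (\<lambda>x. x) w' = (u', v')" by fastforce
    then have "m = (u @ u', v @ v')"
      using w(2) w' x by simp
    moreover have "(u, v) \<in> X" "(u, v) \<noteq> ([], [])"
      using w(1) w' x by auto
    ultimately show ?thesis
      using X(2) by blast
  qed
  \<comment> \<open>A kernel word \<open>w\<close> gives the element \<open>(w, [])\<close> (or \<open>([], w)\<close>), whose first factor is a generator.\<close>
  have ker1: "\<exists>k. 1 \<le> k \<and> k \<le> K \<and> \<phi> (take k w) = \<one>\<^bsub>F\<^esub>"
    if w: "w \<in> lists A" "w \<noteq> []" "\<phi> w = \<one>\<^bsub>F\<^esub>" for w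
  proof -
    obtain u u' where "(u, []) \<in> X" "u \<noteq> []" "\<phi> u = \<psi> []" "w = u @ u'"
      using divisor[of "(w, [])"] w one by auto
    then show ?thesis
      using K(1)[of "(u, [])"] one by (intro exI[of _ "length u"]) (simp add: Suc_le_eq)
  qed
  have ker2: "\<exists>k. 1 \<le> k \<and> k \<le> K \<and> \<psi> (take k w) = \<one>\<^bsub>F\<^esub>"
    if w: "w \<in> lists B" "w \<noteq> []" "\<psi> w = \<one>\<^bsub>F\<^esub>" for w
  proof -
    obtain u u' where "([], u) \<in> X" "u \<noteq> []" "\<phi> [] = \<psi> u" "w = u @ u'"
      using divisor[of "([], w)"] w one by auto
    then show ?thesis
      using K(2)[of "([], u)"] one by (intro exI[of _ "length u"]) (simp add: Suc_le_eq)
  qed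
  \<comment> \<open>Cancellation in \<open>F\<close>: componentwise prefixes that lie in the fiber product divide there.\<close>
  have quotient: "(a, b) \<in> carrier ?M"
    if "w \<in> lists A" "w' \<in> lists B" "\<phi> w = \<psi> w'" "\<phi> u = \<psi> v" "w = u @ a" "w' = v @ b"
    for w w' u a v b
  proof -
    have lists: "u \<in> lists A" "a \<in> lists A" "v \<in> lists B" "b \<in> lists B"
      using that by simp_all
    have "\<phi> u \<otimes>\<^bsub>F\<^esub> \<phi> a = \<phi> u \<otimes>\<^bsub>F\<^esub> \<psi> b"
      using hom_mult[OF hom(1), of u a] hom_mult[OF hom(2), of v b] that lists by simp
    moreover have "\<phi> u \<in> carrier F" "\<phi> a \<in> carrier F" "\<psi> b \<in> carrier F"
      using lists hom_in_carrier[OF hom(1)] hom_in_carrier[OF hom(2)] by simp_all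
    ultimately show ?thesis using lists by simp
  qed
  show ?thesis
  proof (rule M.finitely_presented_if_bounded_common_multiples[OF X,
        where len = "\<lambda>(u, v). length u + length v" and C = "4 * K"])
    fix x y p q
    assume *: "x \<in> X" "y \<in> X" "p \<in> carrier ?M" "q \<in> carrier ?M" "x \<otimes>\<^bsub>?M\<^esub> p = y \<otimes>\<^bsub>?M\<^esub> q"
    obtain x1 x2 y1 y2 p1 p2 q1 q2
      where pairs: "x = (x1, x2)" "y = (y1, y2)" "p = (p1, p2)" "q = (q1, q2)"
      by (metis surj_pair)
    define u v where "u = x1 @ p1" and "v = x2 @ p2"
    have uy: "u = y1 @ q1" "v = y2 @ q2"
      using *(5) pairs by (simp_all add: u_def v_def)
    have xy: "x \<in> carrier ?M" "y \<in> carrier ?M" using * X by auto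
    have m: "(u, v) \<in> carrier ?M"
      using M.m_closed[OF xy(1) *(3)] unfolding pairs u_def v_def by (simp del: append_in_lists_conv)
    have uv: "u \<in> lists A" "v \<in> lists B" "\<phi> u = \<psi> v"
      using m by auto
    have prefixes: "prefix x1 u" "prefix x2 v" "prefix y1 u" "prefix y2 v"
      by (simp_all add: u_def v_def) (simp_all add: uy flip: u_def v_def)
    have images: "\<phi> x1 = \<psi> x2" "\<phi> y1 = \<psi> y2"
      using xy pairs by simp_all
    have lengths: "length x1 \<le> K" "length x2 \<le> K" "length y1 \<le> K" "length y2 \<le> K"
      using K[OF *(1)] K[OF *(2)] pairs by simp_all
    obtain z1 z2 where z: "prefix x1 z1" "prefix y1 z1" "prefix z1 u" "prefix x2 z2" "prefix y2 z2"
        "prefix z2 v" "\<phi> z1 = \<psi> z2" "length z1 + length z2 \<le> 4 * K"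
    proof -
      have "\<exists>z1 z2. prefix x1 z1 \<and> prefix y1 z1 \<and> prefix z1 u \<and> prefix x2 z2 \<and> prefix y2 z2 \<and>
        prefix z2 v \<and> \<phi> z1 = \<psi> z2 \<and> length z1 + length z2 \<le> 4 * K"
        by (rule bounded_common_extension[OF
              prefix_with_same_image[OF F.is_group assms(3) ker1]
              prefix_with_same_image[OF F.is_group assms(4) ker2]])
          (use uv prefixes images lengths in blast)+
      then show ?thesis using that by blast
    qed
    obtain a1 a2 b1 b2 c1 c2 where abc: "z1 = x1 @ a1" "z2 = x2 @ a2" "z1 = y1 @ b1" "z2 = y2 @ b2"
        "u = z1 @ c1" "v = z2 @ c2"
      using z by (meson prefixE)
    have "z1 \<in> lists A" "z2 \<in> lists B"
      using uv(1,2) abc(5,6) by simp_all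
    note z_lists = this z(7)
    have "(a1, a2) \<in> carrier ?M" "(b1, b2) \<in> carrier ?M" "(c1, c2) \<in> carrier ?M"
      using quotient[OF z_lists images(1) abc(1,2)] quotient[OF z_lists images(2) abc(3,4)]
        quotient[OF uv z(7) abc(5,6)] by blast+
    moreover have "x \<otimes>\<^bsub>?M\<^esub> (a1, a2) = (z1, z2)" "y \<otimes>\<^bsub>?M\<^esub> (b1, b2) = (z1, z2)"
      using abc pairs by simp_all
    moreover have "(z1, z2) \<otimes>\<^bsub>?M\<^esub> (c1, c2) = x \<otimes>\<^bsub>?M\<^esub> p"
      using abc(5,6) pairs by (simp add: u_def v_def)
    ultimately show "\<exists>a\<in>carrier ?M. \<exists>b\<in>carrier ?M. \<exists>c\<in>carrier ?M.
        x \<otimes>\<^bsub>?M\<^esub> a = y \<otimes>\<^bsub>?M\<^esub> b \<and> x \<otimes>\<^bsub>?M\<^esub> a \<otimes>\<^bsub>?M\<^esub> c = x \<otimes>\<^bsub>?M\<^esub> p \<and>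
        (case x \<otimes>\<^bsub>?M\<^esub> a of (u, v) \<Rightarrow> length u + length v) \<le> 4 * K"
      using z(8) by (metis case_prod_conv)
  qed auto
qed

end
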